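(* Let $g\ge 1$, let $C$ be a nonseparating simple closed curve in the closed orientable surface $S_{g+1}$ of genus $g+1$, and let $t_C$ be the left-handed Dehn twist about $C$. Let $1\le \ell<2n$, and suppose that $h\in\mathrm{Mod}(S_{g+1})$ is a side-exchanging fractional power of $t_C$ of exponent $\ell/\!/2n$ given by the SE data set $D=((\ell,2n),g_0,a;(k_1,n_1),\dots,(k_m,n_m))$ (of genus $g$). Then: (a) $n$ is odd if $\ell$ is odd; and (b) $2n\ge \dfrac{2g+m}{2g_0+m-1}$.
   Context: $\mathrm{Mod}(S)$ is the mapping class group of the closed oriented surface $S$. A fractional power of $t_C$ of exponent $\ell/\!/N$ (a formal symbol recording the pair $(\ell,N)$) is an $h\in\mathrm{Mod}(S)$ with $h^N=t_C^{\ell}$. Such an $h$ preserves the isotopy class of $C$, so one may take a representative with $h(C)=C$. It is side-exchanging if it interchanges the two sides of $C$, and side-preserving otherwise. An SE data set of exponent $\ell/\!/2n$ is a tuple $((\ell,2n),g_0,a;(k_1,n_1),\dots,(k_m,n_m))$ where: (i) $\ell,n,g_0$ and the $n_i$ are integers with $\ell\ge 2$, $n\ge 2$, $g_0\ge 0$, each $n_i>1$, and each $n_i$ divides $2n$; (ii) $a$ is a residue modulo $n$ with $\gcd(a,n)=1$, and each $k_i$ is a residue modulo $n_i$ with $\gcd(k_i,n_i)=1$; (iii) $\ell a\equiv 2\pmod n$; (iv) $2a+\sum_{i=1}^m\frac{2n}{n_i}k_i\equiv 0\pmod{2n}$. Its genus is $g=n(2g_0-1)+\sum_{i=1}^m\frac{n}{n_i}(n_i-1)$.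 Two SE data sets are considered the same if they differ by reordering the pairs $(k_i,n_i)$. The data set (of genus $g$) giving the conjugacy class of $h$: remove an invariant open annular neighborhood of $C$ and cap off the two resulting boundary circles with disks with centers $P,Q$, obtaining $S_g$; $h$ induces a generator $t$ of a $C_{2n}$-action on $S_g$ interchanging $P$ and $Q$. The quotient orbifold has genus $g_0$, one distinguished cone point of order $n$ (the common image of $P$ and $Q$) and $m$ other cone points of orders $n_1,\dots,n_m$. The residue $a$ is the inverse modulo $n$ of $k$, where $2\pi k/n$ is the (common) rotation angle of $t^2$ at $P$ and $Q$, and $k_i$ is the inverse modulo $n_i$ of $k_i'$, where $2\pi k_i'/n_i$ is the rotation angle of $t^{2n/n_i}$ at the points over the $i$-th other cone point. *)

theory Defs
  imports "HOL-Complex_Analysis.Complex_Analysis" "HOL-Algebra.Group" "HOL-Number_Theory.Cong"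
begin

section \<open>Closed oriented surfaces\<close>

text \<open>Local degree \<open>1\<close> at \<open>z\<close>, for a map that is continuous and injective near \<open>z\<close> (for such a
  map the local degree is \<open>1\<close> or \<open>-1\<close>).\<close>

definition orientation_preserving_at :: "(complex \<Rightarrow> complex) \<Rightarrow> complex \<Rightarrow> bool" where
  "orientation_preserving_at f z \<longleftrightarrow>
     (\<exists>e>0. \<forall>r. 0 < r \<and> r < e \<longrightarrow> winding_number (f \<circ> circlepath z r) (f z) = 1)"

text \<open>A surface is carried by an abstract topology, and its orientation by an atlas of charts
  \<open>(U, \<phi>)\<close> with orientation-preserving transition maps.\<close>

record 'a osurface =
  top_of :: "'a topology"
  atlas :: "('a set \<times> ('a \<Rightarrow> complex)) set"

definition is_chart :: "'a topology \<Rightarrow> 'a set \<Rightarrow> ('a \<Rightarrow> complex) \<Rightarrow> bool" where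
  "is_chart X U \<phi> \<longleftrightarrow> openin X U \<and> open (\<phi> ` U) \<and>
     homeomorphic_map (subtopology X U) (top_of_set (\<phi> ` U)) \<phi>"

text \<open>For a map \<open>f\<close> that restricts to a homeomorphism from a neighbourhood of \<open>x\<close> onto an open set:
  \<open>f\<close> preserves the orientations at \<open>x\<close>. Only the values of \<open>inv_into U \<phi>\<close> near \<open>\<phi> x\<close> matter.\<close>

definition oriented_at :: "'a osurface \<Rightarrow> 'b osurface \<Rightarrow> ('a \<Rightarrow> 'b) \<Rightarrow> 'a \<Rightarrow> bool" where
  "oriented_at S S' f x \<longleftrightarrow>
     (\<forall>(U, \<phi>) \<in> atlas S. \<forall>(V, \<psi>) \<in> atlas S'.
        x \<in> U \<and> f x \<in> V \<longrightarrow> orientation_preserving_at (\<psi> \<circ> f \<circ> inv_into U \<phi>) (\<phi> x))"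

definition closed_oriented_surface :: "'a osurface \<Rightarrow> bool" where
  "closed_oriented_surface S \<longleftrightarrow>
     topspace (top_of S) \<noteq> {} \<and> connected_space (top_of S) \<and>
     compact_space (top_of S) \<and> Hausdorff_space (top_of S) \<and>
     (\<forall>(U, \<phi>) \<in> atlas S. is_chart (top_of S) U \<phi>) \<and>
     (\<Union>(U, \<phi>) \<in> atlas S. U) = topspace (top_of S) \<and>
     (\<forall>x \<in> topspace (top_of S). oriented_at S S (\<lambda>y. y) x)"

text \<open>An open subset of the plane with its standard orientation.\<close>

definition planar :: "complex set \<Rightarrow> complex osurface" where
  "planar W = \<lparr>top_of = top_of_set W, atlas = {(W, \<lambda>z. z)}\<rparr>"

definition simple_closed_curve :: "'a topology \<Rightarrow> 'a set \<Rightarrow> bool" where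
  "simple_closed_curve X C \<longleftrightarrow> C \<subseteq> topspace X \<and>
     subtopology X C homeomorphic_space top_of_set (sphere (0::complex) 1)"

text \<open>The genus is the maximal number of disjoint simple closed curves whose union does not
  separate the (closed orientable) surface.\<close>

definition nonseparating_system :: "'a topology \<Rightarrow> 'a set set \<Rightarrow> bool" where
  "nonseparating_system X \<C> \<longleftrightarrow>
     finite \<C> \<and> (\<forall>C\<in>\<C>. simple_closed_curve X C) \<and> disjoint \<C> \<and>
     connectedin X (topspace X - \<Union>\<C>)"

definition has_genus :: "'a topology \<Rightarrow> nat \<Rightarrow> bool" where
  "has_genus X g \<longleftrightarrow>
     (\<exists>\<C>. nonseparating_system X \<C> \<and> card \<C> = g) \<and>
     (\<forall>\<C>. nonseparating_system X \<C> \<longrightarrow> card \<C> \<le> g)"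

definition closed_surface :: "'a osurface \<Rightarrow> nat \<Rightarrow> bool" where
  "closed_surface S g \<longleftrightarrow> closed_oriented_surface S \<and> has_genus (top_of S) g"


section \<open>The mapping class group\<close>

definition homeo_plus :: "'a osurface \<Rightarrow> ('a \<Rightarrow> 'a) set" where
  "homeo_plus S = {f. homeomorphic_map (top_of S) (top_of S) f \<and>
                      (\<forall>x \<in> topspace (top_of S). oriented_at S S f x)}"

text \<open>Isotopy is homotopy through homeomorphisms. The values of a map outside
  \<open>topspace (top_of S)\<close> are irrelevant: maps agreeing on \<open>topspace (top_of S)\<close> are isotopic.\<close>

definition isotopy_rel :: "'a osurface \<Rightarrow> (('a \<Rightarrow> 'a) \<times> ('a \<Rightarrow> 'a)) set" where
  "isotopy_rel S = {(f, f'). f \<in> homeo_plus S \<and> f' \<in> homeo_plus S \<and>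
     homotopic_with (homeomorphic_map (top_of S) (top_of S)) (top_of S) (top_of S) f f'}"

definition MCG :: "'a osurface \<Rightarrow> ('a \<Rightarrow> 'a) set monoid" where
  "MCG S = \<lparr>carrier = homeo_plus S // isotopy_rel S,
            monoid.mult = (\<lambda>p q. isotopy_rel S `` {f \<circ> f' | f f'. f \<in> p \<and> f' \<in> q}),
            one = isotopy_rel S `` {\<lambda>x. x}\<rparr>"


section \<open>Dehn twists and fractional powers\<close>

definition closed_annulus :: "complex set" where
  "closed_annulus = {z. 1 \<le> norm z \<and> norm z \<le> 2}"

definition open_annulus :: "complex set" where
  "open_annulus = {z. 1 < norm z \<and> norm z < 2}"

text \<open>\<open>\<alpha>\<close> is an orientation-preserving parametrization of a closed annular neighbourhood of \<open>C\<close>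
  in which \<open>C\<close> is the core circle.\<close>

definition annular_nbhd :: "'a osurface \<Rightarrow> 'a set \<Rightarrow> (complex \<Rightarrow> 'a) \<Rightarrow> bool" where
  "annular_nbhd S C \<alpha> \<longleftrightarrow>
     embedding_map (top_of_set closed_annulus) (top_of S) \<alpha> \<and>
     (\<forall>z \<in> open_annulus. oriented_at (planar open_annulus) S \<alpha> z) \<and>
     C = \<alpha> ` sphere 0 (3/2)"

text \<open>An arc crossing the annulus outwards is made to turn left by this map, since it is sent to an
  arc that runs once around the annulus counterclockwise while moving outwards. Inwards arcs
  (and hence the orientation-preserving reparametrization \<open>z \<mapsto> 2 / z\<close>) give the same direction.\<close>

definition left_twist :: "complex \<Rightarrow> complex" where
  "left_twist z = z * cis (2 * pi * (norm z - 1))"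

definition twist_along :: "(complex \<Rightarrow> 'a) \<Rightarrow> 'a \<Rightarrow> 'a" where
  "twist_along \<alpha> x = (if x \<in> \<alpha> ` closed_annulus
                       then \<alpha> (left_twist (inv_into closed_annulus \<alpha> x)) else x)"

text \<open>All twists along annular neighbourhoods of \<open>C\<close> are isotopic, so this is one isotopy class.\<close>

definition Dehn_twist :: "'a osurface \<Rightarrow> 'a set \<Rightarrow> ('a \<Rightarrow> 'a) set" where
  "Dehn_twist S C = isotopy_rel S `` {twist_along \<alpha> | \<alpha>. annular_nbhd S C \<alpha>}"

text \<open>\<open>h\<close> is a fractional power of the twist about \<open>C\<close>, of exponent \<open>l // N\<close>.\<close>

definition fractional_power ::
  "'a osurface \<Rightarrow> 'a set \<Rightarrow> nat \<Rightarrow> nat \<Rightarrow> ('a \<Rightarrow> 'a) set \<Rightarrow> bool" where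
  "fractional_power S C l N h \<longleftrightarrow> h \<in> carrier (MCG S) \<and>
     h [^]\<^bsub>MCG S\<^esub> N = Dehn_twist S C [^]\<^bsub>MCG S\<^esub> l"

text \<open>The two sides of \<open>C\<close> are the germs along \<open>C\<close> of the two components of \<open>A - C\<close>, for an annular
  neighbourhood \<open>A\<close> of \<open>C\<close>; the set \<open>W\<close> is needed because \<open>H\<close> need not preserve \<open>A\<close>.\<close>

definition exchanges_sides :: "'a osurface \<Rightarrow> 'a set \<Rightarrow> ('a \<Rightarrow> 'a) \<Rightarrow> bool" where
  "exchanges_sides S C H \<longleftrightarrow> H ` C = C \<and>
     (\<exists>\<alpha> W. annular_nbhd S C \<alpha> \<and> openin (top_of S) W \<and> C \<subseteq> W \<and> W \<subseteq> \<alpha> ` open_annulus \<and>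
        H ` (W \<inter> \<alpha> ` {z. 1 < norm z \<and> norm z < 3/2}) \<subseteq> \<alpha> ` {z. 3/2 < norm z \<and> norm z < 2} \<and>
        H ` (W \<inter> \<alpha> ` {z. 3/2 < norm z \<and> norm z < 2}) \<subseteq> \<alpha> ` {z. 1 < norm z \<and> norm z < 3/2})"

definition side_exchanging :: "'a osurface \<Rightarrow> 'a set \<Rightarrow> ('a \<Rightarrow> 'a) set \<Rightarrow> bool" where
  "side_exchanging S C h \<longleftrightarrow> (\<exists>H \<in> h. exchanges_sides S C H)"


section \<open>SE data sets\<close>

text \<open>\<open>SE l n g0 a ks\<close> stands for the tuple \<open>((l, 2n), g0, a; (k1, n1), ..., (km, nm))\<close>.
  A residue is given by any integer representing it; everything below depends only on the residue
  classes, and not on the order of the list \<open>ks\<close>.\<close>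

datatype SE_tuple = SE nat nat nat int "(int \<times> nat) list"

fun SE_data_set :: "SE_tuple \<Rightarrow> bool" where
  "SE_data_set (SE l n g0 a ks) \<longleftrightarrow>
     2 \<le> l \<and> 2 \<le> n \<and> (\<forall>(k, ni) \<in> set ks. 1 < ni \<and> ni dvd 2 * n) \<and>
     coprime a (int n) \<and> (\<forall>(k, ni) \<in> set ks. coprime k (int ni)) \<and>
     [int l * a = 2] (mod int n) \<and>
     [2 * a + (\<Sum>(k, ni) \<leftarrow> ks. int (2 * n div ni) * k) = 0] (mod int (2 * n))"

text \<open>The quotients \<open>n / ni\<close> may be half-integers, hence the type.\<close>

fun SE_genus :: "SE_tuple \<Rightarrow> real" where
  "SE_genus (SE l n g0 a ks) =
     real n * (2 * real g0 - 1) + (\<Sum>(k, ni) \<leftarrow> ks. real n / real ni * (real ni - 1))"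


section \<open>The data set of a side-exchanging fractional power\<close>

text \<open>\<open>f\<close> fixes \<open>x\<close>, and near \<open>x\<close> it is the rotation by the angle \<open>\<theta>\<close> in an oriented coordinate disk
  centered at \<open>x\<close>.\<close>

definition rotation_at :: "'b osurface \<Rightarrow> ('b \<Rightarrow> 'b) \<Rightarrow> 'b \<Rightarrow> real \<Rightarrow> bool" where
  "rotation_at Y f x \<theta> \<longleftrightarrow>
     (\<exists>\<beta>. embedding_map (top_of_set (ball 0 1)) (top_of Y) \<beta> \<and>
          openin (top_of Y) (\<beta> ` ball 0 1) \<and>
          (\<forall>z \<in> ball 0 1. oriented_at (planar (ball 0 1)) Y \<beta> z) \<and>
          \<beta> 0 = x \<and> (\<forall>z \<in> ball 0 1. f (\<beta> z) = \<beta> (cis \<theta> * z)))"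

text \<open>\<open>Y\<close> arises from \<open>S\<close> by removing the open annulus \<open>\<alpha> ` open_annulus\<close> and capping off the two
  boundary circles with disks with centers \<open>P\<close> and \<open>Q\<close>; \<open>e\<close> is the inclusion of what remains of \<open>S\<close>.\<close>

definition capped_off ::
  "'a osurface \<Rightarrow> (complex \<Rightarrow> 'a) \<Rightarrow> 'b osurface \<Rightarrow> ('a \<Rightarrow> 'b) \<Rightarrow> 'b \<Rightarrow> 'b \<Rightarrow> bool" where
  "capped_off S \<alpha> Y e P Q \<longleftrightarrow>
     (let R = topspace (top_of S) - \<alpha> ` open_annulus in
      closed_oriented_surface Y \<and>
      embedding_map (subtopology (top_of S) R) (top_of Y) e \<and>
      (\<forall>x \<in> topspace (top_of S) - \<alpha> ` closed_annulus. oriented_at S Y e x) \<and>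
      (\<exists>\<delta> \<epsilon>. embedding_map (top_of_set (cball (0::complex) 1)) (top_of Y) \<delta> \<and>
             embedding_map (top_of_set (cball (0::complex) 1)) (top_of Y) \<epsilon> \<and>
             \<delta> 0 = P \<and> \<epsilon> 0 = Q \<and>
             \<delta> ` cball 0 1 \<inter> \<epsilon> ` cball 0 1 = {} \<and>
             e ` R \<union> \<delta> ` cball 0 1 \<union> \<epsilon> ` cball 0 1 = topspace (top_of Y) \<and>
             e ` R \<inter> \<delta> ` ball 0 1 = {} \<and> \<delta> ` sphere 0 1 = e ` \<alpha> ` sphere 0 1 \<and>
             e ` R \<inter> \<epsilon> ` ball 0 1 = {} \<and> \<epsilon> ` sphere 0 1 = e ` \<alpha> ` sphere 0 2))"

definition orbit_of :: "('b \<Rightarrow> 'b) \<Rightarrow> 'b \<Rightarrow> 'b set" where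
  "orbit_of t x = range (\<lambda>j. (t ^^ j) x)"

definition generates_cyclic_action :: "'b osurface \<Rightarrow> ('b \<Rightarrow> 'b) \<Rightarrow> nat \<Rightarrow> bool" where
  "generates_cyclic_action Y t N \<longleftrightarrow> t \<in> homeo_plus Y \<and>
     (\<forall>x \<in> topspace (top_of Y). (t ^^ N) x = x) \<and>
     (\<forall>j. 0 < j \<and> j < N \<longrightarrow> (\<exists>x \<in> topspace (top_of Y). (t ^^ j) x \<noteq> x))"

text \<open>The quotient orbifold has underlying space the orbit space \<open>B\<close>, and its cone points are the
  orbits of points with nontrivial stabilizer. Such an orbit has \<open>2n / ni\<close> points exactly if the
  stabilizers, and hence the cone point, have order \<open>ni\<close>.\<close>

fun orbifold_data :: "'b osurface \<Rightarrow> ('b \<Rightarrow> 'b) \<Rightarrow> 'b \<Rightarrow> 'b \<Rightarrow> SE_tuple \<Rightarrow> bool" where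
  "orbifold_data Y t P Q (SE l n g0 a ks) \<longleftrightarrow>
     (\<exists>B. quotient_map (top_of Y) B (orbit_of t) \<and> has_genus B g0) \<and>
     (\<exists>k::int. [a * k = 1] (mod int n) \<and>
        rotation_at Y (t ^^ 2) P (2 * pi * of_int k / real n) \<and>
        rotation_at Y (t ^^ 2) Q (2 * pi * of_int k / real n)) \<and>
     (\<exists>x :: nat \<Rightarrow> 'b.
        {y \<in> topspace (top_of Y). y \<notin> {P, Q} \<and> (\<exists>j. 0 < j \<and> j < 2 * n \<and> (t ^^ j) y = y)}
          = (\<Union>i < length ks. orbit_of t (x i)) \<and>
        inj_on (\<lambda>i. orbit_of t (x i)) {..<length ks} \<and>
        (\<forall>i < length ks. case ks ! i of (ki, ni) \<Rightarrow>
           card (orbit_of t (x i)) * ni = 2 * n \<and>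
           (\<exists>k'::int. [ki * k' = 1] (mod int ni) \<and>
              (\<forall>y \<in> orbit_of t (x i).
                 rotation_at Y (t ^^ (2 * n div ni)) y (2 * pi * of_int k' / real ni)))))"

text \<open>\<open>D\<close> is the data set obtained from \<open>h\<close>, using the model \<open>Y\<close> of the capped-off surface. Here \<open>H\<close>
  is a representative of \<open>h\<close> that preserves an annulus around \<open>C\<close> and has finite order outside it.\<close>

fun has_data_set ::
  "'a osurface \<Rightarrow> 'a set \<Rightarrow> 'b osurface \<Rightarrow> ('a \<Rightarrow> 'a) set \<Rightarrow> SE_tuple \<Rightarrow> bool" where
  "has_data_set S C Y h (SE l n g0 a ks) \<longleftrightarrow>
     (\<exists>H \<in> h. \<exists>\<alpha> e P Q t.
        H ` C = C \<and> annular_nbhd S C \<alpha> \<and> H ` \<alpha> ` open_annulus = \<alpha> ` open_annulus \<and>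
        capped_off S \<alpha> Y e P Q \<and>
        generates_cyclic_action Y t (2 * n) \<and> t P = Q \<and> t Q = P \<and>
        (\<forall>x \<in> topspace (top_of S) - \<alpha> ` open_annulus. t (e x) = e (H x)) \<and>
        orbifold_data Y t P Q (SE l n g0 a ks))"

end

theory Submission
  imports Defs
begin

text \<open>Both claims follow from the arithmetic of the data set alone. If \<open>n\<close> were even, \<open>a\<close> would be
  odd, and \<open>l a \<equiv> 2 (mod n)\<close> would force \<open>l\<close> to be even. In the genus formula, \<open>ni \<le> 2n\<close> bounds
  each summand \<open>n - n / ni\<close> by \<open>n - 1/2\<close>, so \<open>2g + m \<le> 2n (2 g0 + m - 1)\<close>; as the left-hand side
  is positive, so is \<open>2 g0 + m - 1\<close>.\<close>

lemma odd_if_mult_cong_2: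
  fixes a :: int
  assumes "[int l * a = 2] (mod int n)" "coprime a (int n)" "odd l"
  shows "odd n"
proof
  assume "even n"
  \<comment> \<open>As 2 divides \<open>n\<close>, the congruence descends to modulus 2, where its
    right-hand side vanishes.\<close>
  then have "[int l * a = 2] (mod 2)"
    using assms(1) by (auto intro: cong_dvd_modulus)
  then have "even (int l * a)"
    by (simp add: cong_def even_iff_mod_2_eq_zero)
  with assms(3) have "even a"
    by simp
  with \<open>even n\<close> assms(2) show False
    by (auto dest: coprime_common_divisor)
qed

lemma sum_list_cone_terms_le:
  assumes "\<forall>(k :: int, ni) \<in> set ks. 1 < ni \<and> ni dvd 2 * n" "0 < n"
  shows "(\<Sum>(k, ni) \<leftarrow> ks. real n / real ni * (real ni - 1)) \<le> real (length ks) * (real n - 1 / 2)"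
proof -
  have "real n / real ni * (real ni - 1) \<le> real n - 1 / 2" if "(k, ni) \<in> set ks" for k ni
  proof -
    from that assms have "1 < ni" "ni \<le> 2 * n"
      by (auto intro: dvd_imp_le)
    then show ?thesis
      by (simp add: field_simps)
  qed
  then have "(\<Sum>(k, ni) \<leftarrow> ks. real n / real ni * (real ni - 1)) \<le> (\<Sum>_ \<leftarrow> ks. real n - 1 / 2)"
    by (intro sum_list_mono) auto
  then show ?thesis
    by (simp add: sum_list_triv)
qed

text \<open>Doubling the genus turns the saving of 1/2 per cone point into \<open>length ks\<close>
  in total, which cancels the term added on the left.\<close>

lemma SE_genus_bound:
  assumes "SE_data_set (SE l n g0 a ks)"
  shows "2 * SE_genus (SE l n g0 a ks) + real (length ks)
    \<le> 2 * real n * (2 * real g0 + real (length ks) - 1)"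
  using sum_list_cone_terms_le[of ks n] assms by (simp add: algebra_simps)

theorem corollary3p7:
  fixes S :: "'a osurface" and Y :: "'b osurface" and C :: "'a set" and h :: "('a \<Rightarrow> 'a) set"
    and g l n g0 :: nat and a :: int and ks :: "(int \<times> nat) list"
  assumes "g \<ge> 1"
    and "closed_surface S (g + 1)"
    and "simple_closed_curve (top_of S) C"
    and "connectedin (top_of S) (topspace (top_of S) - C)"
    and "1 \<le> l" and "l < 2 * n"
    and "fractional_power S C l (2 * n) h"
    and "side_exchanging S C h"
    and "SE_data_set (SE l n g0 a ks)"
    and "SE_genus (SE l n g0 a ks) = real g"
    and "closed_surface Y g"
    and "has_data_set S C Y h (SE l n g0 a ks)"
  shows "(odd l \<longrightarrow> odd n) \<and>
    2 * real n \<ge> (2 * real g + real (length ks)) / (2 * real g0 + real (length ks) - 1)"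
proof
  show "odd l \<longrightarrow> odd n"
    using assms(9) odd_if_mult_cong_2 by auto
next
  let ?d = "2 * real g0 + real (length ks) - 1"
  have bound: "2 * real g + real (length ks) \<le> 2 * real n * ?d"
    using SE_genus_bound[OF assms(9)] assms(10) by simp
  \<comment> \<open>Here \<open>g \<ge> 1\<close> enters: it fixes the sign of \<open>?d\<close>, so
    dividing by \<open>?d\<close> keeps the direction of the inequality.\<close>
  moreover have "0 < 2 * real g + real (length ks)"
    using assms(1) by simp
  ultimately have "0 < 2 * real n * ?d"
    by linarith
  then have "0 < ?d"
    by (simp add: zero_less_mult_iff)
  with bound show "2 * real n \<ge> (2 * real g + real (length ks)) / ?d"
    by (simp add: pos_divide_le_eq)
qed

end
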